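(* Let $G$ be a $d$-regular directed graph with equitable partition $\pi=\{C_1,\dots,C_r\}$ of equal cell size, and normalized characteristic matrix $Q$. Let $A=\sum_{j=1}^dP_j$ and $\widetilde A=\sum_{j=1}^d\widetilde P_j$ be shunt decompositions of the adjacency matrices of $G$ and of $G/\pi$. Then $$(I_d\otimes Q^\top)\,S\,(I_d\otimes Q)=\widetilde S$$ if and only if $P_jQ=Q\widetilde P_j$ for each $j=1,\dots,d$, where $S=\sum_{j=1}^dE_{jj}\otimes P_j$ is the shift matrix of $G$ and $\widetilde S=\sum_{j=1}^dE_{jj}\otimes\widetilde P_j$ is the quotient shift matrix of $G/\pi$.
   Context: A directed graph is $d$-regular if all in- and out-degrees equal $d$. A partition $\pi=\{C_1,\dots,C_r\}$ of the vertex set is equitable if every vertex of $C_i$ has the same number $b_{ij}$ of out-neighbours in $C_j$; the quotient graph $G/\pi$ is the directed multigraph on the cells with adjacency matrix $\widetilde A=(b_{ij})$ (it is $d$-regular here). The normalized characteristic matrix $Q$ has $(u,i)$ entry $|C_i|^{-1/2}$ if $u\in C_i$ and $0$ otherwise, so $Q^\top Q=I$. A shunt decomposition of a $d$-regular directed graph writes its adjacency matrix as a sum of $d$ permutation matrices. $E_{jj}$ denotes the $d\times d$ matrix with $1$ in position $(j,j)$ and zeros elsewhere. *)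

theory Defs
  imports "HOL-Analysis.Analysis" "HOL-Library.Disjoint_Sets" "Graph_Theory.Digraph"
begin

text \<open>
  Matrices are indexed by finite types. A matrix with rows indexed by \<open>'m\<close> and
  columns indexed by \<open>'n\<close> has type \<open>real^'n^'m\<close>.
\<close>

definition d_regular :: "('v, 'e) pre_digraph \<Rightarrow> nat \<Rightarrow> bool" where
  "d_regular G d \<longleftrightarrow> (\<forall>v \<in> verts G. in_degree G v = d \<and> out_degree G v = d)"

text \<open>Entries count parallel arcs, so this applies to directed multigraphs as well.\<close>

definition adjacency_matrix :: "('v::finite, 'e) pre_digraph \<Rightarrow> real^'v^'v" where
  "adjacency_matrix G = (\<chi> u v. real (card {e \<in> arcs G. tail G e = u \<and> head G e = v}))"

definition out_neighbours_in :: "('v, 'e) pre_digraph \<Rightarrow> 'v \<Rightarrow> 'v set \<Rightarrow> 'v set" where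
  "out_neighbours_in G u X = {v \<in> X. (u, v) \<in> arcs_ends G}"

text \<open>The cells of a partition form an injective family \<open>C\<close> over the finite index type.\<close>

definition equitable_partition :: "('v, 'e) pre_digraph \<Rightarrow> ('r \<Rightarrow> 'v set) \<Rightarrow> bool" where
  "equitable_partition G C \<longleftrightarrow>
     inj C \<and> partition_on (verts G) (range C) \<and>
     (\<forall>i j. \<exists>b. \<forall>u \<in> C i. card (out_neighbours_in G u (C j)) = b)"

text \<open>The number \<open>b\<^sub>i\<^sub>j\<close>; it is well defined when \<open>C\<close> is an equitable partition.\<close>

definition cell_degree :: "('v, 'e) pre_digraph \<Rightarrow> ('r \<Rightarrow> 'v set) \<Rightarrow> 'r \<Rightarrow> 'r \<Rightarrow> nat" where
  "cell_degree G C i j = (THE b. \<forall>u \<in> C i. card (out_neighbours_in G u (C j)) = b)"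

text \<open>The \<open>k\<close>-th of the \<open>b\<^sub>i\<^sub>j\<close> parallel arcs from cell \<open>i\<close> to cell \<open>j\<close> is \<open>(i, j, k)\<close>.\<close>

definition quotient_graph ::
    "('v, 'e) pre_digraph \<Rightarrow> ('r \<Rightarrow> 'v set) \<Rightarrow> ('r, 'r \<times> 'r \<times> nat) pre_digraph" where
  "quotient_graph G C =
     \<lparr> verts = UNIV,
       arcs = {(i, j, k). k < cell_degree G C i j},
       tail = (\<lambda>(i, j, k). i),
       head = (\<lambda>(i, j, k). j) \<rparr>"

lemma cell_degree_eq:
  assumes "equitable_partition G C" "u \<in> C i"
  shows "cell_degree G C i j = card (out_neighbours_in G u (C j))"
  using assms unfolding cell_degree_def equitable_partition_def
  by (intro the_equality) metis+

lemma adjacency_matrix_quotient_graph: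
  "adjacency_matrix (quotient_graph G C) $ i $ j = real (cell_degree G C i j)"
proof -
  have "{e \<in> arcs (quotient_graph G C).
           tail (quotient_graph G C) e = i \<and> head (quotient_graph G C) e = j}
        = (\<lambda>k. (i, j, k)) ` {..<cell_degree G C i j}"
    by (auto simp: quotient_graph_def)
  then show ?thesis
    by (simp add: adjacency_matrix_def card_image inj_on_def)
qed

definition normalized_characteristic_matrix :: "('r::finite \<Rightarrow> 'v::finite set) \<Rightarrow> real^'r^'v" where
  "normalized_characteristic_matrix C =
     (\<chi> u i. if u \<in> C i then real (card (C i)) powr (- 1 / 2) else 0)"

definition is_permutation_matrix :: "real^'n^'n \<Rightarrow> bool" where
  "is_permutation_matrix M \<longleftrightarrow>
     (\<exists>\<sigma>. bij \<sigma> \<and> M = (\<chi> u v. if v = \<sigma> u then 1 else 0))"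

text \<open>The number of summands is \<open>CARD('d)\<close>.\<close>

definition shunt_decomposition ::
    "('v::finite, 'e) pre_digraph \<Rightarrow> ('d::finite \<Rightarrow> real^'v^'v) \<Rightarrow> bool" where
  "shunt_decomposition G P \<longleftrightarrow>
     (\<forall>j. is_permutation_matrix (P j)) \<and> adjacency_matrix G = (\<Sum>j\<in>UNIV. P j)"

definition kronecker ::
    "real^'n^'m \<Rightarrow> real^'q^'p \<Rightarrow> real^('n \<times> 'q)^('m \<times> 'p)" (infixl \<open>\<otimes>\<^sub>K\<close> 75) where
  "A \<otimes>\<^sub>K B = (\<chi> a b. A $ fst a $ fst b * B $ snd a $ snd b)"

definition matrix_unit :: "'d \<Rightarrow> 'd \<Rightarrow> real^'d^'d" where
  "matrix_unit j k = (\<chi> a b. if a = j \<and> b = k then 1 else 0)"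

definition shift_matrix ::
    "('d::finite \<Rightarrow> real^'n^'n) \<Rightarrow> real^('d \<times> 'n)^('d \<times> 'n)" where
  "shift_matrix P = (\<Sum>j\<in>UNIV. matrix_unit j j \<otimes>\<^sub>K P j)"

end

theory Submission
  imports Defs
begin

text \<open>
  Both sides decouple along the index \<open>j\<close>, so the claim is that, for isometries \<open>P\<close>, \<open>P'\<close> and
  \<open>Q\<^sup>T Q = I\<close>, the compression \<open>Q\<^sup>T P Q = P'\<close> already forces the intertwining \<open>P Q = Q P'\<close>.
  Indeed \<open>D = P Q - Q P'\<close> then satisfies \<open>D\<^sup>T D = I - P'\<^sup>T P' - P'\<^sup>T P' + P'\<^sup>T P' = 0\<close>.
\<close>

lemma transpose_diff:
  fixes A B :: "real^'n^'m"
  shows "transpose (A - B) = transpose A - transpose B"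
  by (simp add: transpose_def vec_eq_iff)

lemma matrix_diff_ldistrib:
  fixes A :: "real^'n^'m" and B C :: "real^'k^'n"
  shows "A ** (B - C) = A ** B - A ** C"
  by (simp add: matrix_matrix_mult_def vec_eq_iff right_diff_distrib sum_subtractf)

lemma matrix_diff_rdistrib:
  fixes A B :: "real^'n^'m" and C :: "real^'k^'n"
  shows "(A - B) ** C = A ** C - B ** C"
  by (simp add: matrix_matrix_mult_def vec_eq_iff left_diff_distrib sum_subtractf)

text \<open>The diagonal entries of \<open>transpose A ** A\<close> are the squared norms of the
  columns of \<open>A\<close>, and over the reals a vanishing sum of squares has only zero
  terms.\<close>

lemma transpose_mult_self_eq_0:
  fixes A :: "real^'n^'m"
  assumes "transpose A ** A = 0"
  shows "A = 0"
proof -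
  have "A $ i $ j = 0" for i j
  proof -
    have "(\<Sum>k\<in>UNIV. A $ k $ j * A $ k $ j) = (transpose A ** A) $ j $ j"
      by (simp add: matrix_matrix_mult_def transpose_def)
    then have "(\<Sum>k\<in>UNIV. A $ k $ j * A $ k $ j) = 0"
      by (simp add: assms)
    then show ?thesis
      by (simp add: sum_nonneg_eq_0_iff)
  qed
  then show ?thesis
    by (simp add: vec_eq_iff)
qed

lemma compression_eq_iff_intertwine:
  fixes Q :: "real^'r^'v" and U :: "real^'v^'v" and V :: "real^'r^'r"
  assumes Q: "transpose Q ** Q = mat 1"
    and U: "transpose U ** U = mat 1"
    and V: "transpose V ** V = mat 1"
  shows "transpose Q ** U ** Q = V \<longleftrightarrow> U ** Q = Q ** V"
proof
  assume "U ** Q = Q ** V"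
  then have "transpose Q ** U ** Q = transpose Q ** Q ** V"
    by (metis matrix_mul_assoc)
  then show "transpose Q ** U ** Q = V"
    by (simp add: Q)
next
  assume compr: "transpose Q ** U ** Q = V"
  define X where "X = U ** Q"
  define Y where "Y = Q ** V"
  have QX: "transpose Q ** X = V"
    using compr by (simp add: X_def matrix_mul_assoc)
  have XX: "transpose X ** X = mat 1"
  proof -
    have "transpose X ** X = transpose Q ** (transpose U ** U) ** Q"
      by (simp add: X_def matrix_transpose_mul matrix_mul_assoc)
    then show ?thesis
      by (simp add: U Q)
  qed
  \<comment> \<open>In this direction the compression hypothesis enters here, through
    \<open>QX\<close>: the mixed product is \<open>transpose V ** (transpose Q ** X)\<close>, which
    collapses to \<open>transpose V ** V\<close>.\<close>
  have YX: "transpose Y ** X = mat 1"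
    by (metis QX V Y_def matrix_mul_assoc matrix_transpose_mul)
  have XY: "transpose X ** Y = mat 1"
    by (metis YX matrix_transpose_mul transpose_mat transpose_transpose)
  have YY: "transpose Y ** Y = mat 1"
  proof -
    have "transpose Y ** Y = transpose V ** (transpose Q ** Q) ** V"
      by (simp add: Y_def matrix_transpose_mul matrix_mul_assoc)
    then show ?thesis
      by (simp add: Q V)
  qed
  have "transpose (X - Y) ** (X - Y) = 0"
    by (simp add: transpose_diff matrix_diff_ldistrib matrix_diff_rdistrib XX XY YX YY)
  then have "X - Y = 0"
    by (rule transpose_mult_self_eq_0)
  then show "U ** Q = Q ** V"
    by (simp add: X_def Y_def)
qed

lemma permutation_matrix_isometric:
  assumes "is_permutation_matrix M"
  shows "transpose M ** M = mat 1"
proof -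
  obtain \<sigma> where \<sigma>: "bij \<sigma>" and M: "M = (\<chi> u v. if v = \<sigma> u then 1 else 0)"
    using assms by (auto simp: is_permutation_matrix_def)
  have "(\<Sum>k\<in>UNIV. (if i = \<sigma> k then 1 else 0) * (if j = \<sigma> k then 1 else 0))
      = (if i = j then 1 else (0::real))" for i j
  proof -
    \<comment> \<open>Both factors depend on \<open>k\<close> only through
      \<open>\<sigma> k\<close>, so bijectivity allows summing over the image instead.\<close>
    have "(\<Sum>k\<in>UNIV. (if i = \<sigma> k then 1 else 0) * (if j = \<sigma> k then 1 else 0))
        = (\<Sum>k\<in>UNIV. (if i = k then 1 else 0) * (if j = k then 1 else (0::real)))"
      using sum.reindex_bij_betw[OF \<sigma>,
          of "\<lambda>k. (if i = k then 1 else 0) * (if j = k then 1 else (0::real))"] by simp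
    also have "\<dots> = (\<Sum>k\<in>UNIV. if i = k then (if j = k then 1 else 0) else 0)"
      by (rule sum.cong) auto
    finally show ?thesis
      by auto
  qed
  then show ?thesis
    by (simp add: M matrix_matrix_mult_def transpose_def mat_def vec_eq_iff)
qed

text \<open>The columns are scaled indicator vectors of the cells: disjoint supports make them
  orthogonal, and the scaling gives a nonempty cell norm 1.\<close>

lemma normalized_characteristic_matrix_isometric:
  fixes C :: "'r::finite \<Rightarrow> 'v::finite set"
  assumes "disjoint_family C" and "\<And>i. C i \<noteq> {}"
  shows "transpose (normalized_characteristic_matrix C) ** normalized_characteristic_matrix C
    = mat 1"
proof -
  define c where "c i = real (card (C i)) powr (- 1 / 2)" for i
  \<comment> \<open>Nonemptiness matters: since \<open>0 powr x = 0\<close>, an empty cell would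
    yield a zero column.\<close>
  have c: "real (card (C i)) * (c i * c i) = 1" for i
  proof -
    have "real (card (C i)) > 0"
      using assms(2) by (simp add: card_gt_0_iff)
    then show ?thesis
      by (simp add: c_def powr_add[symmetric] powr_minus_divide assms(2))
  qed
  have "(\<Sum>u\<in>UNIV. (if u \<in> C i then c i else 0) * (if u \<in> C j then c j else 0))
      = (if i = j then 1 else 0)" for i j
  proof -
    have "(\<Sum>u\<in>UNIV. (if u \<in> C i then c i else 0) * (if u \<in> C j then c j else 0))
        = (\<Sum>u\<in>UNIV. if u \<in> C i \<inter> C j then c i * c j else 0)"
      by (rule sum.cong) auto
    also have "\<dots> = real (card (C i \<inter> C j)) * (c i * c j)"
      by (simp add: sum.If_cases Int_def)
    finally show ?thesis
      using c assms(1) by (auto simp: disjoint_family_on_def)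
  qed
  moreover have "normalized_characteristic_matrix C = (\<chi> u i. if u \<in> C i then c i else 0)"
    by (simp only: normalized_characteristic_matrix_def c_def)
  ultimately show ?thesis
    by (simp add: matrix_matrix_mult_def transpose_def mat_def vec_eq_iff)
qed

text \<open>The inner sum runs over pairs, and its summand splits into a factor for each coordinate,
  so it is a product of two sums.\<close>

lemma kronecker_mult:
  "(A \<otimes>\<^sub>K B) ** (A' \<otimes>\<^sub>K B') = (A ** A') \<otimes>\<^sub>K (B ** B')"
  by (simp add: kronecker_def matrix_matrix_mult_def vec_eq_iff sum_product
      sum.cartesian_product mult_ac case_prod_beta flip: UNIV_Times_UNIV)

lemma shift_matrix_nth:
  "shift_matrix P $ (a, u) $ (b, v) = (if a = b then P a $ u $ v else 0)"
proof -
  have "shift_matrix P $ (a, u) $ (b, v)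
      = (\<Sum>j\<in>UNIV. if a = j then (if b = j then P j $ u $ v else 0) else 0)"
    unfolding shift_matrix_def kronecker_def matrix_unit_def sum_component
    by (rule sum.cong) auto
  then show ?thesis
    by simp
qed

text \<open>A shift matrix is block diagonal with blocks \<open>P j\<close>, so each block can be
  read off from it. This is what decouples the theorem along \<open>j\<close>.\<close>

lemma shift_matrix_eq_iff:
  "shift_matrix P = shift_matrix P' \<longleftrightarrow> (\<forall>j. P j = P' j)"
  by (metis shift_matrix_nth vec_eq_iff ext)

lemma matrix_mult_sum_right:
  fixes A :: "real^'n^'m" and B :: "'i \<Rightarrow> real^'k^'n"
  shows "A ** (\<Sum>i\<in>I. B i) = (\<Sum>i\<in>I. A ** B i)"
  by (induction I rule: infinite_finite_induct) (simp_all add: matrix_add_ldistrib)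

lemma matrix_mult_sum_left:
  fixes A :: "'i \<Rightarrow> real^'n^'m" and B :: "real^'k^'n"
  shows "(\<Sum>i\<in>I. A i) ** B = (\<Sum>i\<in>I. A i ** B)"
  by (simp add: matrix_matrix_mult_def vec_eq_iff sum_distrib_right sum.swap[of _ I])

text \<open>By the mixed-product rule, applied to each summand, the identity factors leave the
  matrix units unchanged and \<open>R\<close>, \<open>T\<close> act on each block
  separately.\<close>

lemma kronecker_mat_1_shift_matrix:
  fixes R :: "real^'n^'m" and T :: "real^'m^'n" and P :: "'d::finite \<Rightarrow> real^'n^'n"
  shows "((mat 1 :: real^'d^'d) \<otimes>\<^sub>K R) ** shift_matrix P ** ((mat 1 :: real^'d^'d) \<otimes>\<^sub>K T)
    = shift_matrix (\<lambda>j. R ** P j ** T)"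
  by (simp add: shift_matrix_def matrix_mult_sum_right matrix_mult_sum_left kronecker_mult)

theorem lemma3p2:
  fixes G :: "('v::finite, 'e) pre_digraph"
    and C :: "'r::finite \<Rightarrow> 'v set"
    and P :: "'d::finite \<Rightarrow> real^'v^'v"
    and P' :: "'d \<Rightarrow> real^'r^'r"
    and Q :: "real^'r^'v"
  assumes "fin_digraph G" and "nomulti_digraph G" and "verts G = UNIV"
    and "d_regular G CARD('d)"
    and "equitable_partition G C"
    and "\<forall>i j. card (C i) = card (C j)"
    and "Q = normalized_characteristic_matrix C"
    and "shunt_decomposition G P"
    and "shunt_decomposition (quotient_graph G C) P'"
  shows "((mat 1 :: real^'d^'d) \<otimes>\<^sub>K transpose Q) ** shift_matrix P ** ((mat 1 :: real^'d^'d) \<otimes>\<^sub>K Q)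
           = shift_matrix P'
         \<longleftrightarrow> (\<forall>j. P j ** Q = Q ** P' j)"
proof -
  have inj: "inj C" and part: "partition_on (verts G) (range C)"
    using assms(5) by (auto simp: equitable_partition_def)
  \<comment> \<open>A partition only makes distinct members of \<open>range C\<close> disjoint;
    injectivity carries this over to distinct indices.\<close>
  have "disjoint_family C"
    using inj partition_onD2[OF part]
    by (auto simp: disjoint_family_on_def disjoint_def inj_eq)
  moreover have "C i \<noteq> {}" for i
    using partition_onD3[OF part] by (metis rangeI)
  ultimately have Q: "transpose Q ** Q = mat 1"
    unfolding assms(7) by (rule normalized_characteristic_matrix_isometric)
  have "transpose (P j) ** P j = mat 1" "transpose (P' j) ** P' j = mat 1" for j
    using assms(8,9) by (simp_all add: shunt_decomposition_def permutation_matrix_isometric)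
  then show ?thesis
    by (simp add: kronecker_mat_1_shift_matrix shift_matrix_eq_iff
        compression_eq_iff_intertwine[OF Q])
qed

end
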